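(* Let $K,M\ge 2$ be integers and $\mathcal{H}_{KM}=\mathcal{H}_K\otimes\mathcal{H}_M$, where $\mathcal{H}_K,\mathcal{H}_M$ are complex Hilbert spaces of dimensions $K$ and $M$. For every Hermitian operator $X$ on $\mathcal{H}_{KM}$, $$\lambda_{\max}^{\otimes}(X)\ \ge\ \lambda_{K+M-1}(X)\qquad\text{and}\qquad \lambda_{\min}^{\otimes}(X)\ \le\ \lambda_{(K-1)(M-1)+1}(X).$$ Furthermore, there exist Hermitian operators $X_1$ and $X_2$ on $\mathcal{H}_{KM}$ such that $$\lambda_{\max}^{\otimes}(X_1)<\lambda_{K+M}(X_1)\qquad\text{and}\qquad \lambda_{\min}^{\otimes}(X_2)>\lambda_{(K-1)(M-1)}(X_2).$$
   Context: For a Hermitian operator $X$ on $\mathcal{H}_{KM}$, $\lambda_1(X)\le\lambda_2(X)\le\dots\le\lambda_{KM}(X)$ denote its eigenvalues in nondecreasing order, repeated according to multiplicity. $\lambda_{\max}^{\otimes}(X)$ and $\lambda_{\min}^{\otimes}(X)$ denote the maximum and the minimum of $\langle\psi_A\otimes\psi_B|X|\psi_A\otimes\psi_B\rangle$ over all unit vectors $\psi_A\in\mathcal{H}_K$ and $\psi_B\in\mathcal{H}_M$. *)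

theory Defs
  imports
    "HOL-Computational_Algebra.Fundamental_Theorem_Algebra"
    "HOL-Analysis.Function_Topology"
    "HOL-Analysis.Topology_Euclidean_Space"
    "Jordan_Normal_Form.Schur_Decomposition"
begin

no_notation Finite_Cartesian_Product.vec_nth (infixl "$" 90)
hide_type (open) Finite_Cartesian_Product.vec
hide_const (open) Finite_Cartesian_Product.vec

definition hermitian :: "complex mat \<Rightarrow> bool" where
  "hermitian X \<longleftrightarrow> mat_adjoint X = X"

(* The eigenvalues with algebraic multiplicity; for a Hermitian matrix they are real (see
   hermitian_eigenvalue_real below) and Re discards nothing. *)
definition sorted_eigvals :: "complex mat \<Rightarrow> real list" where
  "sorted_eigvals X = sorted_list_of_multiset (image_mset Re (proots (char_poly X)))"

(* The index is 1-based: eigval 1 X is the smallest eigenvalue. *)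
definition eigval :: "nat \<Rightarrow> complex mat \<Rightarrow> real" where
  "eigval k X = sorted_eigvals X ! (k - 1)"

(* Kronecker product: the basis vector e_i \<otimes> e_j of C^K \<otimes> C^M is the basis vector with
   index i * M + j of C^(K * M). *)
definition tensor_vec :: "complex vec \<Rightarrow> complex vec \<Rightarrow> complex vec" where
  "tensor_vec u v =
     vec (dim_vec u * dim_vec v) (\<lambda>i. u $ (i div dim_vec v) * v $ (i mod dim_vec v))"

(* In u \<bullet>c v the second argument is conjugated, so this is <psi|X|psi>. *)
definition expect :: "complex mat \<Rightarrow> complex vec \<Rightarrow> complex" where
  "expect X \<psi> = (X *\<^sub>v \<psi>) \<bullet>c \<psi>"

definition unit_vecs :: "nat \<Rightarrow> complex vec set" where
  "unit_vecs n = {\<psi> \<in> carrier_vec n. \<psi> \<bullet>c \<psi> = 1}"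

(* For Hermitian X the expectations are real, see hermitian_expect_real below. *)
definition product_values :: "nat \<Rightarrow> nat \<Rightarrow> complex mat \<Rightarrow> real set" where
  "product_values K M X =
     {Re (expect X (tensor_vec a b)) | a b. a \<in> unit_vecs K \<and> b \<in> unit_vecs M}"

(* The maximum and minimum exist by compactness, see product_values_max and product_values_min
   below. *)
definition lambda_max_prod :: "nat \<Rightarrow> nat \<Rightarrow> complex mat \<Rightarrow> real" where
  "lambda_max_prod K M X = (GREATEST r. r \<in> product_values K M X)"

definition lambda_min_prod :: "nat \<Rightarrow> nat \<Rightarrow> complex mat \<Rightarrow> real" where
  "lambda_min_prod K M X = (LEAST r. r \<in> product_values K M X)"

lemma length_sorted_eigvals:
  assumes "X \<in> carrier_mat n n"
  shows "length (sorted_eigvals X) = n"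
proof -
  have "length (sorted_eigvals X) = size (image_mset Re (proots (char_poly X)))"
    unfolding sorted_eigvals_def by (metis mset_sorted_list_of_multiset size_mset)
  then show ?thesis
    using degree_monic_char_poly[OF assms] by (simp add: size_proots_complex)
qed

lemma hermitian_index:
  assumes "hermitian X" "X \<in> carrier_mat n n" "i < n" "j < n"
  shows "cnj (X $$ (i, j)) = X $$ (j, i)"
proof -
  have "X $$ (j, i) = mat_adjoint X $$ (j, i)"
    using assms(1) by (simp add: hermitian_def)
  also have "\<dots> = cnj (X $$ (i, j))"
    using assms(2-4) by (simp add: mat_adjoint_def mat_of_rows_def)
  finally show ?thesis by simp
qed

lemma expect_sum:
  assumes "X \<in> carrier_mat n n" "\<psi> \<in> carrier_vec n"
  shows "expect X \<psi> = (\<Sum>i<n. (\<Sum>j<n. X $$ (i, j) * \<psi> $ j) * cnj (\<psi> $ i))"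
  using assms
  by (auto simp: expect_def scalar_prod_def atLeast0LessThan intro!: sum.cong)

lemma hermitian_expect_real:
  assumes "hermitian X" "X \<in> carrier_mat n n" "\<psi> \<in> carrier_vec n"
  shows "expect X \<psi> \<in> \<real>"
proof -
  have "cnj (expect X \<psi>) = (\<Sum>i<n. \<Sum>j<n. X $$ (j, i) * cnj (\<psi> $ j) * \<psi> $ i)"
    unfolding expect_sum[OF assms(2,3)]
    using hermitian_index[OF assms(1,2)]
    by (auto simp: sum_distrib_right intro!: sum.cong)
  also have "\<dots> = (\<Sum>i<n. \<Sum>j<n. X $$ (i, j) * cnj (\<psi> $ i) * \<psi> $ j)"
    by (rule sum.swap)
  also have "\<dots> = expect X \<psi>"
    unfolding expect_sum[OF assms(2,3)]
    by (simp add: sum_distrib_left mult.commute mult.left_commute)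
  finally show ?thesis
    by (simp add: Reals_cnj_iff)
qed

lemma hermitian_eigenvalue_real:
  assumes "hermitian X" "X \<in> carrier_mat n n" "x \<in># proots (char_poly X)"
  shows "x \<in> \<real>"
proof -
  have "char_poly X \<noteq> 0"
    using degree_monic_char_poly[OF assms(2)] by auto
  then have "poly (char_poly X) x = 0"
    using assms(3) by simp
  then obtain v where v: "v \<in> carrier_vec n" "v \<noteq> 0\<^sub>v n" "X *\<^sub>v v = x \<cdot>\<^sub>v v"
    using eigenvalue_root_char_poly[OF assms(2)] assms(2)
    by (auto simp: eigenvalue_def eigenvector_def)
  have e: "expect X v = x * (v \<bullet>c v)"
    using v by (simp add: expect_def)
  have nz: "v \<bullet>c v \<noteq> 0"
    using v conjugate_square_eq_0_vec by blast
  have "v \<bullet>c v = expect (1\<^sub>m n) v"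
    using v by (simp add: expect_def)
  also have "\<dots> \<in> \<real>"
    by (rule hermitian_expect_real[of _ n])
      (use v in \<open>auto simp: hermitian_def mat_adjoint_def mat_of_rows_def\<close>)
  finally have "v \<bullet>c v \<in> \<real>" .
  moreover have "x = expect X v / (v \<bullet>c v)"
    using e nz by simp
  ultimately show ?thesis
    using hermitian_expect_real[OF assms(1,2) v(1)] by simp
qed

definition unit_funs :: "nat \<Rightarrow> (nat \<Rightarrow> complex) set" where
  "unit_funs n = PiE UNIV (\<lambda>i. if i < n then cball 0 1 else {0})
                 \<inter> {f. (\<Sum>i<n. f i * cnj (f i)) = 1}"

lemma compact_unit_funs: "compact (unit_funs n)"
proof -
  have "compactin (product_topology (\<lambda>i. euclidean) UNIV)
          (PiE UNIV (\<lambda>i::nat. if i < n then cball (0::complex) 1 else {0}))"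
    by (subst compactin_PiE) (auto simp: compactin_euclidean_iff)
  then have "compact (PiE UNIV (\<lambda>i::nat. if i < n then cball (0::complex) 1 else {0}))"
    by (simp add: euclidean_product_topology flip: compactin_euclidean_iff)
  moreover have "closed {f :: nat \<Rightarrow> complex. (\<Sum>i<n. f i * cnj (f i)) = 1}"
    by (intro closed_Collect_eq continuous_intros continuous_on_product_coordinates)
  ultimately show ?thesis
    unfolding unit_funs_def by (rule compact_Int_closed)
qed

lemma unit_vecs_eq: "unit_vecs n = vec n ` unit_funs n"
proof (intro equalityI subsetI)
  fix v assume "v \<in> unit_vecs n"
  then have v: "v \<in> carrier_vec n" "v \<bullet>c v = 1"
    by (auto simp: unit_vecs_def)
  define f where "f i = (if i < n then v $ i else 0)" for i
  have s: "(\<Sum>i<n. f i * cnj (f i)) = 1"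
    using v by (auto simp: f_def scalar_prod_def atLeast0LessThan)
  have "norm (f i) \<le> 1" if "i < n" for i
  proof -
    have "(\<Sum>i<n. (norm (f i))\<^sup>2) = 1"
      using s unfolding complex_norm_square[symmetric]
      by (metis (no_types, lifting) of_real_eq_1_iff of_real_sum sum.cong)
    moreover have "(norm (f i))\<^sup>2 \<le> (\<Sum>i<n. (norm (f i))\<^sup>2)"
      using that by (intro member_le_sum) auto
    ultimately show ?thesis
      by (simp add: abs_square_le_1)
  qed
  then have "f \<in> unit_funs n"
    using s by (auto simp: unit_funs_def f_def)
  moreover have "v = vec n f"
    using v by (auto simp: f_def)
  ultimately show "v \<in> vec n ` unit_funs n" by blast
qed (auto simp: unit_funs_def unit_vecs_def scalar_prod_def atLeast0LessThan)

lemma unit_funs_nonempty: "n > 0 \<Longrightarrow> unit_funs n \<noteq> {}"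
proof -
  assume "n > 0"
  then have "(\<lambda>i. if i = 0 then 1 else 0) \<in> unit_funs n"
    by (auto simp: unit_funs_def if_distrib cong: if_cong)
  then show ?thesis by blast
qed

lemma compact_product_values:
  assumes "X \<in> carrier_mat (K * M) (K * M)"
  shows "compact (product_values K M X)"
proof -
  define F where "F = (\<lambda>(f, g). \<Sum>i<K*M. (\<Sum>j<K*M. X $$ (i, j) * (f (j div M) * g (j mod M)))
                       * cnj (f (i div M) * (g (i mod M) :: complex)))"
  have "expect X (tensor_vec (vec K f) (vec M g)) = F (f, g)" for f g
  proof -
    have lt: "i div M < K" "i mod M < M" if "i < K * M" for i
      using that by (auto simp: less_mult_imp_div_less intro!: mod_less_divisor gr0I)
    have "tensor_vec (vec K f) (vec M g) \<in> carrier_vec (K * M)"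
      by (simp add: tensor_vec_def)
    then show ?thesis
      using lt by (auto simp: expect_sum[OF assms] F_def tensor_vec_def intro!: sum.cong)
  qed
  moreover have "product_values K M X =
      (\<lambda>(f, g). Re (expect X (tensor_vec (vec K f) (vec M g)))) ` (unit_funs K \<times> unit_funs M)"
    unfolding product_values_def unit_vecs_eq by (auto simp: image_iff)
  ultimately have "product_values K M X = (\<lambda>p. Re (F p)) ` (unit_funs K \<times> unit_funs M)"
    by (simp add: case_prod_unfold)
  moreover have "continuous_on (unit_funs K \<times> unit_funs M) (\<lambda>p. Re (F p))"
  proof -
    have 1: "continuous_on S (\<lambda>p :: (nat \<Rightarrow> complex) \<times> (nat \<Rightarrow> complex). fst p i)" for S i
      by (rule continuous_on_product_then_coordinatewise)
        (intro continuous_intros)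
    have 2: "continuous_on S (\<lambda>p :: (nat \<Rightarrow> complex) \<times> (nat \<Rightarrow> complex). snd p i)" for S i
      by (rule continuous_on_product_then_coordinatewise)
        (intro continuous_intros)
    show ?thesis
      unfolding F_def case_prod_unfold
      by (intro continuous_intros 1 2)
  qed
  ultimately show ?thesis
    by (simp add: compact_continuous_image compact_Times compact_unit_funs)
qed

lemma product_values_nonempty: "K > 0 \<Longrightarrow> M > 0 \<Longrightarrow> product_values K M X \<noteq> {}"
  using unit_funs_nonempty[of K] unit_funs_nonempty[of M]
  unfolding product_values_def unit_vecs_eq by blast

lemma product_values_max:
  assumes "X \<in> carrier_mat (K * M) (K * M)" "K > 0" "M > 0"
  shows "lambda_max_prod K M X \<in> product_values K M X"
    and "r \<in> product_values K M X \<Longrightarrow> r \<le> lambda_max_prod K M X"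
proof -
  obtain m where "m \<in> product_values K M X" "\<forall>r\<in>product_values K M X. r \<le> m"
    using compact_attains_sup[OF compact_product_values product_values_nonempty] assms by metis
  moreover from this have "lambda_max_prod K M X = m"
    unfolding lambda_max_prod_def by (intro Greatest_equality) auto
  ultimately show "lambda_max_prod K M X \<in> product_values K M X"
    and "r \<in> product_values K M X \<Longrightarrow> r \<le> lambda_max_prod K M X"
    by auto
qed

lemma product_values_min:
  assumes "X \<in> carrier_mat (K * M) (K * M)" "K > 0" "M > 0"
  shows "lambda_min_prod K M X \<in> product_values K M X"
    and "r \<in> product_values K M X \<Longrightarrow> lambda_min_prod K M X \<le> r"
proof -
  obtain m where "m \<in> product_values K M X" "\<forall>r\<in>product_values K M X. m \<le> r"
    using compact_attains_inf[OF compact_product_values product_values_nonempty] assms by metis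
  moreover from this have "lambda_min_prod K M X = m"
    unfolding lambda_min_prod_def by (intro Least_equality) auto
  ultimately show "lambda_min_prod K M X \<in> product_values K M X"
    and "r \<in> product_values K M X \<Longrightarrow> lambda_min_prod K M X \<le> r"
    by auto
qed

end

theory Submission
  imports Defs
begin

text \<open>Let \<open>a \<otimes> b\<close> maximize the form of \<open>X\<close> over the unit product vectors, with value \<open>\<mu>\<close>. The
  form of \<open>X - \<mu>\<close> is nonpositive on product vectors and vanishes at \<open>a \<otimes> b\<close>; averaging it along
  \<open>(a + \<tau> u) \<otimes> (b + \<tau> v)\<close> over the phases of \<open>\<tau>\<close> shows that it is nonpositive on the tangent
  space of all \<open>u \<otimes> b + a \<otimes> v\<close>. This space has dimension \<open>K + M - 1\<close>, so the Courant-Fischer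
  principle gives \<open>\<lambda>\<^bsub>K+M-1\<^esub>(X) \<le> \<mu>\<close>. The bound for the minimum is the same statement for
  \<open>- X\<close>.

  The bounds are sharp because multiplication of polynomials of degrees less than \<open>K\<close> and \<open>M\<close>
  is a linear map \<open>A\<close> from \<open>C\<^sup>K \<otimes> C\<^sup>M\<close> to \<open>C\<^bsup>K+M-1\<^esup>\<close> whose kernel, of dimension at least
  \<open>(K - 1)(M - 1)\<close>, contains no nonzero product vector; take \<open>X\<^sub>2 = A\<^sup>* A\<close> and \<open>X\<^sub>1 = - X\<^sub>2\<close>.\<close>

section \<open>Adjoints and the Hermitian inner product\<close>

lemma adjoint_dims [simp]:
  "dim_row (mat_adjoint A) = dim_col A" "dim_col (mat_adjoint A) = dim_row A"
  by (auto simp: mat_adjoint_def mat_of_rows_def)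

lemma adjoint_carrier [intro]: "A \<in> carrier_mat n m \<Longrightarrow> mat_adjoint A \<in> carrier_mat m n"
  by (intro carrier_matI) simp_all

lemma adjoint_index [simp]:
  "i < dim_col A \<Longrightarrow> j < dim_row A \<Longrightarrow> mat_adjoint A $$ (i, j) = conjugate (A $$ (j, i))"
  by (simp add: mat_adjoint_def mat_of_rows_def)

lemma adjoint_mult:
  fixes A B :: "complex mat"
  assumes "A \<in> carrier_mat n m" "B \<in> carrier_mat m k"
  shows "mat_adjoint (A * B) = mat_adjoint B * mat_adjoint A"
  using assms
  by (intro eq_matI) (auto simp: scalar_prod_def mult.commute intro!: sum.cong)

lemma adjoint_adjoint [simp]: "mat_adjoint (mat_adjoint (A :: complex mat)) = A"
  by (intro eq_matI) auto

lemma adjoint_inner: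
  fixes A :: "complex mat"
  assumes "A \<in> carrier_mat n m" "x \<in> carrier_vec m" "y \<in> carrier_vec n"
  shows "(A *\<^sub>v x) \<bullet>c y = x \<bullet>c (mat_adjoint A *\<^sub>v y)"
proof -
  have "(A *\<^sub>v x) \<bullet>c y = (\<Sum>i<n. \<Sum>j<m. A $$ (i, j) * x $ j * cnj (y $ i))"
    using assms by (auto simp: scalar_prod_def atLeast0LessThan sum_distrib_right intro!: sum.cong)
  also have "\<dots> = (\<Sum>j<m. \<Sum>i<n. A $$ (i, j) * x $ j * cnj (y $ i))"
    by (rule sum.swap)
  also have "\<dots> = x \<bullet>c (mat_adjoint A *\<^sub>v y)"
    using assms
    by (auto simp: scalar_prod_def atLeast0LessThan sum_distrib_left mult_ac intro!: sum.cong)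
  finally show ?thesis .
qed

lemma inner_self:
  assumes "x \<in> carrier_vec n"
  shows "x \<bullet>c x = of_real (\<Sum>i<n. (cmod (x $ i))\<^sup>2)"
  using assms
  by (auto simp: scalar_prod_def atLeast0LessThan complex_norm_square simp del: of_real_power
        intro!: sum.cong)

lemma inner_self_pos:
  assumes "x \<in> carrier_vec n" "x \<noteq> 0\<^sub>v n"
  shows "Re (x \<bullet>c x) > 0"
proof -
  obtain i where i: "i < n" "x $ i \<noteq> 0"
    using assms by (metis carrier_vecD eq_vecI index_zero_vec)
  have "(\<Sum>i<n. (cmod (x $ i))\<^sup>2) > 0"
    by (rule sum_pos2[of _ i]) (use i in auto)
  then show ?thesis
    by (simp add: inner_self[OF assms(1)])
qed

lemma mult_mat_unit_vec:
  fixes A :: "complex mat"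
  assumes "A \<in> carrier_mat n m" "j < m"
  shows "A *\<^sub>v unit_vec m j = col A j"
  using assms by (intro eq_vecI) auto

section \<open>The spectral theorem for Hermitian matrices\<close>

lemma unitary_completion:
  fixes v :: "complex vec"
  assumes v: "v \<in> carrier_vec n" and unit: "v \<bullet>c v = 1"
  obtains U where "U \<in> carrier_mat n n" "mat_adjoint U * U = 1\<^sub>m n" "n > 0" "col U 0 = v"
proof -
  have v0: "v \<noteq> 0\<^sub>v n"
    using unit v by auto
  have n: "n > 0"
    using unit v by (cases n) (auto simp: scalar_prod_def)
  interpret cof_vec_space n "TYPE(complex)" .
  note b = basis_completion[OF v v0]
  \<comment> \<open>Gram-Schmidt keeps the first vector \<open>v\<close> and makes the basis
    orthogonal, but not orthonormal. The columns are rescaled by \<open>r\<close> afterwards; as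
    \<open>v\<close> has norm one, \<open>r 0 = 1\<close> and column 0 of \<open>U\<close> is still
    \<open>v\<close>.\<close>
  define ws where "ws = gram_schmidt n (basis_completion v)"
  obtain vs where bv: "basis_completion v = v # vs"
    by (auto simp: basis_completion_def Let_def)
  have ws: "set ws \<subseteq> carrier_vec n" "corthogonal ws" "length ws = n"
    using gram_schmidt_result[OF b(2,4) _ refl, folded ws_def] b by auto
  have hd: "ws ! 0 = v"
    using gram_schmidt_hd[OF v, of vs] n ws(3)
    by (metis bv hd_conv_nth length_0_conv less_numeral_extra(3) ws_def)
  define r where "r i = complex_of_real (1 / sqrt (Re (ws ! i \<bullet>c ws ! i)))" for i
  define U where "U = mat n n (\<lambda>(i, j). r j * ws ! j $ i)"
  have wsc: "ws ! i \<in> carrier_vec n" if "i < n" for i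
    using ws that by auto
  have U: "U \<in> carrier_mat n n"
    by (simp add: U_def)
  have rr: "cnj (r i) * r i * (ws ! i \<bullet>c ws ! i) = 1" if "i < n" for i
  proof -
    have nz: "ws ! i \<bullet>c ws ! i \<noteq> 0"
      using corthogonalD[OF ws(2), of i i] that ws(3) by auto
    define s where "s = (\<Sum>k<n. (cmod (ws ! i $ k))\<^sup>2)"
    have s: "ws ! i \<bullet>c ws ! i = of_real s"
      by (simp add: s_def inner_self[OF wsc[OF that]])
    have "s \<ge> 0" by (simp add: s_def sum_nonneg)
    then have "s > 0" using nz s by (simp add: less_le)
    then have "1 / sqrt s * (1 / sqrt s) * s = 1"
      by simp
    then have "complex_of_real (1 / sqrt s) * complex_of_real (1 / sqrt s) * complex_of_real s = 1"
      unfolding of_real_mult[symmetric] by (simp only: of_real_1)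
    then show ?thesis
      unfolding r_def s Re_complex_of_real complex_cnj_complex_of_real .
  qed
  have "mat_adjoint U * U = 1\<^sub>m n"
  proof (rule eq_matI)
    fix i j assume ij: "i < dim_row (1\<^sub>m n :: complex mat)" "j < dim_col (1\<^sub>m n :: complex mat)"
    then have "(mat_adjoint U * U) $$ (i, j) = (\<Sum>k<n. cnj (r i * ws ! i $ k) * (r j * ws ! j $ k))"
      using U by (auto simp: scalar_prod_def atLeast0LessThan U_def intro!: sum.cong)
    also have "\<dots> = cnj (r i) * r j * (ws ! j \<bullet>c ws ! i)"
      using ij wsc[of i] wsc[of j]
      by (auto simp: scalar_prod_def atLeast0LessThan sum_distrib_left mult_ac intro!: sum.cong)
    also have "\<dots> = 1\<^sub>m n $$ (i, j)"
    proof (cases "i = j")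
      case True
      then show ?thesis using rr ij by simp
    next
      case False
      then have "ws ! j \<bullet>c ws ! i = 0"
        using corthogonalD[OF ws(2), of j i] ij ws(3) by auto
      then show ?thesis using False ij by simp
    qed
    finally show "(mat_adjoint U * U) $$ (i, j) = 1\<^sub>m n $$ (i, j)" .
  qed (use U in auto)
  moreover have "col U 0 = v"
    using n hd unit v by (intro eq_vecI) (auto simp: U_def r_def)
  ultimately show thesis
    using that U n by blast
qed

lemma hermitian_congruence:
  fixes X U :: "complex mat"
  assumes "hermitian X" "X \<in> carrier_mat n n" "U \<in> carrier_mat n m"
  shows "hermitian (mat_adjoint U * X * U)"
proof -
  note Ua = adjoint_carrier[OF assms(3)]
  have "mat_adjoint (mat_adjoint U * X * U) = mat_adjoint U * mat_adjoint (mat_adjoint U * X)"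
    by (rule adjoint_mult[OF mult_carrier_mat[OF Ua assms(2)] assms(3)])
  also have "mat_adjoint (mat_adjoint U * X) = X * U"
    unfolding adjoint_mult[OF Ua assms(2)] using assms(1) by (simp only: hermitian_def adjoint_adjoint)
  finally show ?thesis
    unfolding hermitian_def assoc_mult_mat[OF Ua assms(2,3)] .
qed

lemma congruence_mult:
  fixes X U W :: "complex mat"
  assumes X: "X \<in> carrier_mat n n" and U: "U \<in> carrier_mat n m" and W: "W \<in> carrier_mat m k"
  shows "mat_adjoint (U * W) * X * (U * W) = mat_adjoint W * (mat_adjoint U * X * U) * W"
proof -
  note Ua = adjoint_carrier[OF U] and Wa = adjoint_carrier[OF W]
  note UX = mult_carrier_mat[OF Ua X]
  note UXU = mult_carrier_mat[OF UX U]
  have "mat_adjoint (U * W) * X * (U * W) = mat_adjoint W * (mat_adjoint U * X) * (U * W)"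
    unfolding adjoint_mult[OF U W] assoc_mult_mat[OF Wa Ua X] ..
  also have "\<dots> = mat_adjoint W * (mat_adjoint U * X * (U * W))"
    by (rule assoc_mult_mat[OF Wa UX mult_carrier_mat[OF U W]])
  also have "\<dots> = mat_adjoint W * (mat_adjoint U * X * U * W)"
    unfolding assoc_mult_mat[OF UX U W] ..
  also have "\<dots> = mat_adjoint W * (mat_adjoint U * X * U) * W"
    by (rule assoc_mult_mat[OF Wa UXU W, symmetric])
  finally show ?thesis .
qed

lemma block_diag_mult:
  fixes E F B C :: "'a :: semiring_1 mat"
  assumes "E \<in> carrier_mat k k" "F \<in> carrier_mat k k" "B \<in> carrier_mat m m" "C \<in> carrier_mat m m"
  shows "four_block_mat E (0\<^sub>m k m) (0\<^sub>m m k) B * four_block_mat F (0\<^sub>m k m) (0\<^sub>m m k) C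
    = four_block_mat (E * F) (0\<^sub>m k m) (0\<^sub>m m k) (B * C)"
  by (subst mult_four_block_mat[OF assms(1) zero_carrier_mat zero_carrier_mat assms(3)
      assms(2) zero_carrier_mat zero_carrier_mat assms(4)]) (use assms in simp)

text \<open>Deflation, by induction on the list of roots: a unit eigenvector for the head
  \<open>e\<close> becomes the first column of a unitary matrix, and the complementary block is
  again Hermitian, with the tail as its roots. Since the roots are consumed in the order of
  \<open>es\<close>, the diagonal comes out in any prescribed order, in particular in the sorted
  one.\<close>

theorem hermitian_spectral:
  assumes "hermitian X" "X \<in> carrier_mat n n" "char_poly X = (\<Prod>e\<leftarrow>es. [:- e, 1:])"
  obtains U where "U \<in> carrier_mat n n" "mat_adjoint U * U = 1\<^sub>m n"
    "mat_adjoint U * X * U = mat_diag n (\<lambda>i. es ! i)"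
proof -
  have "\<exists>U \<in> carrier_mat n n. mat_adjoint U * U = 1\<^sub>m n \<and>
      mat_adjoint U * X * U = mat_diag n (\<lambda>i. es ! i)"
    using assms
  proof (induction es arbitrary: n X)
    case Nil
    then have "n = 0"
      using degree_monic_char_poly[of X n] by auto
    then show ?case
      using Nil by (intro bexI[of _ "1\<^sub>m 0"]) (auto simp: mat_diag_def)
  next
    case (Cons e es n X)
    note X = Cons.prems(2) and H = Cons.prems(1)
    have "eigenvalue X e"
      using eigenvalue_root_char_poly[OF X] Cons.prems(3) by simp
    then obtain v0 where v0: "v0 \<in> carrier_vec n" "v0 \<noteq> 0\<^sub>v n" "X *\<^sub>v v0 = e \<cdot>\<^sub>v v0"
      using X by (auto simp: eigenvalue_def eigenvector_def)
    define s where "s = Re (v0 \<bullet>c v0)"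
    have s: "s > 0" "v0 \<bullet>c v0 = of_real s"
      using inner_self_pos[OF v0(1,2)] inner_self[OF v0(1)] by (auto simp: s_def)
    define v where "v = of_real (1 / sqrt s) \<cdot>\<^sub>v v0"
    have v: "v \<in> carrier_vec n" "X *\<^sub>v v = e \<cdot>\<^sub>v v"
      using v0 X by (auto simp: v_def mult_mat_vec smult_smult_assoc mult.commute)
    have "v \<bullet>c v = of_real (1 / sqrt s) * of_real (1 / sqrt s) * of_real s"
      using v0(1) unfolding v_def s(2)[symmetric] by (simp add: conjugate_smult_vec)
    also have "\<dots> = of_real (1 / sqrt s * (1 / sqrt s) * s)"
      unfolding of_real_mult ..
    also have "\<dots> = 1"
      using s(1) by simp
    finally obtain U where U: "U \<in> carrier_mat n n" and UU: "mat_adjoint U * U = 1\<^sub>m n"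
      and n: "n > 0" and colU: "col U 0 = v"
      using unitary_completion[OF v(1)] by metis
    note Ua = adjoint_carrier[OF U]
    define A where "A = mat_adjoint U * X * U"
    have A: "A \<in> carrier_mat n n"
      using U Ua X by (auto simp: A_def)
    have HA: "hermitian A"
      unfolding A_def using hermitian_congruence[OF H X U] .
    have UU': "U * mat_adjoint U = 1\<^sub>m n"
      using mat_mult_left_right_inverse[OF adjoint_carrier[OF U] U UU] .
    have "similar_mat_wit A X (mat_adjoint U) U"
      by (rule similar_mat_witI[of _ _ n]) (use U Ua UU UU' X A in \<open>auto simp: A_def\<close>)
    then have "char_poly A = char_poly X"
      by (intro char_poly_similar) (auto simp: similar_mat_def)
    have "col A 0 = A *\<^sub>v unit_vec n 0"
      using A n by (metis mult_mat_unit_vec)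
    also have "\<dots> = mat_adjoint U *\<^sub>v (X *\<^sub>v (U *\<^sub>v unit_vec n 0))"
      using U Ua X by (simp add: A_def assoc_mult_mat_vec[of _ n n _ n])
    also have "U *\<^sub>v unit_vec n 0 = v"
      using U n colU by (metis mult_mat_unit_vec)
    also have "mat_adjoint U *\<^sub>v (X *\<^sub>v v) = e \<cdot>\<^sub>v (mat_adjoint U *\<^sub>v v)"
      using Ua v by (simp add: mult_mat_vec)
    also have "mat_adjoint U *\<^sub>v v = (mat_adjoint U * U) *\<^sub>v unit_vec n 0"
      using U n colU by (metis adjoint_carrier assoc_mult_mat_vec mult_mat_unit_vec unit_vec_carrier)
    also have "\<dots> = unit_vec n 0"
      by (simp add: UU)
    finally have colA: "col A 0 = e \<cdot>\<^sub>v unit_vec n 0" .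
    define m where "m = n - 1"
    have nm: "n = 1 + m" using n by (simp add: m_def)
    have A_col: "A $$ (i, 0) = (if i = 0 then e else 0)" if "i < n" for i
      using arg_cong[OF colA, of "\<lambda>c. c $ i"] that n A by auto
    \<comment> \<open>Hermiticity carries the zeros of the first column over to the first row, so
      \<open>A\<close> is block diagonal and not merely block triangular.\<close>
    have A_row: "A $$ (0, i) = 0" if "i < n" "i > 0" for i
      using hermitian_index[OF HA A that(1) n] A_col[OF that(1)] that(2) by simp
    define A3 where "A3 = mat m m (\<lambda>(i, j). A $$ (Suc i, Suc j))"
    have A3: "A3 \<in> carrier_mat m m" by (simp add: A3_def)
    let ?E = "mat 1 1 (\<lambda>_. e)"
    have blockA: "A = four_block_mat ?E (0\<^sub>m 1 m) (0\<^sub>m m 1) A3"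
      using A A_col A_row by (intro eq_matI) (auto simp: nm A3_def)
    have HA3: "hermitian A3"
      unfolding hermitian_def
      by (rule eq_matI) (use hermitian_index[OF HA A] in \<open>auto simp: A3_def nm\<close>)
    have "char_poly A = char_poly ?E * char_poly A3"
      unfolding blockA by (rule char_poly_four_block_zeros_col) (auto simp: A3)
    moreover have "char_poly ?E = [:- e, 1:]"
      by (simp add: char_poly_defs det_def sign_def)
    \<comment> \<open>Similarity preserves the characteristic polynomial, so the linear factor of
      the 1 by 1 block can be cancelled and \<open>A3\<close> meets the induction
      hypothesis.\<close>
    ultimately have "[:- e, 1:] * char_poly A3 = [:- e, 1:] * (\<Prod>e\<leftarrow>es. [:- e, 1:])"
      using Cons.prems(3) \<open>char_poly A = char_poly X\<close> by simp
    then have "char_poly A3 = (\<Prod>e\<leftarrow>es. [:- e, 1:])"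
      by (simp only: mult_cancel_left pCons_eq_0_iff one_neq_zero simp_thms)
    then obtain V where V: "V \<in> carrier_mat m m" "mat_adjoint V * V = 1\<^sub>m m"
      "mat_adjoint V * A3 * V = mat_diag m (\<lambda>i. es ! i)"
      using Cons.IH[OF HA3 A3] by blast
    let ?W = "\<lambda>V. four_block_mat (1\<^sub>m 1) (0\<^sub>m 1 m) (0\<^sub>m m 1) V"
    have W: "?W V \<in> carrier_mat n n"
      using V by (auto simp: nm)
    note Va = adjoint_carrier[OF V(1)]
    have Wadj: "mat_adjoint (?W V) = ?W (mat_adjoint V)"
      using V by (intro eq_matI) auto
    have one: "1\<^sub>m 1 \<in> carrier_mat 1 1" and E: "?E \<in> carrier_mat 1 1" by simp_all
    have WW: "mat_adjoint (?W V) * ?W V = 1\<^sub>m n"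
      unfolding Wadj block_diag_mult[OF one one Va V(1)] V(2) nm by simp
    have "mat_adjoint (?W V) * A * ?W V
        = four_block_mat (1\<^sub>m 1 * ?E * 1\<^sub>m 1) (0\<^sub>m 1 m) (0\<^sub>m m 1) (mat_adjoint V * A3 * V)"
      unfolding Wadj blockA block_diag_mult[OF one E Va A3]
        block_diag_mult[OF mult_carrier_mat[OF one E] one mult_carrier_mat[OF Va A3] V(1)] ..
    also have "\<dots> = mat_diag n (\<lambda>i. (e # es) ! i)"
      unfolding V(3) by (intro eq_matI) (auto simp: nm mat_diag_def)
    finally have WAW: "mat_adjoint (?W V) * A * ?W V = mat_diag n (\<lambda>i. (e # es) ! i)" .
    show ?case
    proof (intro bexI[of _ "U * ?W V"] conjI)
      have "mat_adjoint (U * ?W V) * 1\<^sub>m n * (U * ?W V) = 1\<^sub>m n"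
        unfolding congruence_mult[OF one_carrier_mat U W] right_mult_one_mat[OF Ua] UU
          right_mult_one_mat[OF adjoint_carrier[OF W]] WW ..
      then show "mat_adjoint (U * ?W V) * (U * ?W V) = 1\<^sub>m n"
        unfolding right_mult_one_mat[OF adjoint_carrier[OF mult_carrier_mat[OF U W]]] .
      show "mat_adjoint (U * ?W V) * X * (U * ?W V) = mat_diag n (\<lambda>i. (e # es) ! i)"
        unfolding congruence_mult[OF X U W] using WAW unfolding A_def .
      show "U * ?W V \<in> carrier_mat n n"
        by (rule mult_carrier_mat[OF U W])
    qed
  qed
  then show thesis using that by blast
qed

text \<open>All roots are real, so taking real parts and embedding them back leaves the multiset of
  roots unchanged; over the complex numbers a monic polynomial is the product of its linear
  factors.\<close>

lemma char_poly_sorted_eigvals: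
  assumes "hermitian X" "X \<in> carrier_mat n n"
  shows "char_poly X = (\<Prod>e\<leftarrow>map complex_of_real (sorted_eigvals X). [:- e, 1:])"
proof -
  let ?P = "proots (char_poly X)"
  have "mset (map complex_of_real (sorted_eigvals X))
      = image_mset (\<lambda>x. complex_of_real (Re x)) ?P"
    by (simp add: sorted_eigvals_def multiset.map_comp comp_def)
  also have "\<dots> = image_mset (\<lambda>x. x) ?P"
    by (rule image_mset_cong) (use hermitian_eigenvalue_real[OF assms] in auto)
  finally have "(\<Prod>e\<leftarrow>map complex_of_real (sorted_eigvals X). [:- e, 1:])
      = (\<Prod>e\<in>#?P. [:- e, 1:])"
    by (metis multiset.map_ident mset_map prod_mset_prod_list)
  also have "\<dots> = char_poly X"
    using complex_poly_decompose_multiset[of "char_poly X"] degree_monic_char_poly[OF assms(2)]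
    by simp
  finally show ?thesis ..
qed

text \<open>This is the form in which the spectral theorem enters the eigenvalue bounds: in the
  unitary coordinates of an eigenbasis the form is a sum of squares whose weights are the
  eigenvalues in nondecreasing order, and the norm is unchanged.\<close>

lemma hermitian_coordinates:
  assumes "hermitian X" "X \<in> carrier_mat n n"
  obtains U where "U \<in> carrier_mat n n"
    "\<forall>x \<in> carrier_vec n.
       Re (expect X x) = (\<Sum>i<n. sorted_eigvals X ! i * (cmod ((mat_adjoint U *\<^sub>v x) $ i))\<^sup>2)"
    "\<forall>x \<in> carrier_vec n.
       Re (x \<bullet>c x) = (\<Sum>i<n. (cmod ((mat_adjoint U *\<^sub>v x) $ i))\<^sup>2)"
proof -
  let ?es = "map complex_of_real (sorted_eigvals X)"
  note X = assms(2)
  obtain U where U: "U \<in> carrier_mat n n" and UU: "mat_adjoint U * U = 1\<^sub>m n"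
    and D: "mat_adjoint U * X * U = mat_diag n (\<lambda>i. ?es ! i)"
    using hermitian_spectral[OF assms char_poly_sorted_eigvals[OF assms]] by blast
  note Ua = adjoint_carrier[OF U]
  have UU': "U * mat_adjoint U = 1\<^sub>m n"
    using mat_mult_left_right_inverse[OF Ua U UU] .
  have move: "(mat_adjoint U *\<^sub>v z) \<bullet>c y = z \<bullet>c (U *\<^sub>v y)"
    if "z \<in> carrier_vec n" "y \<in> carrier_vec n" for y z
    using adjoint_inner[OF Ua that] by simp
  show thesis
  proof (rule that[OF U]; rule ballI)
    fix x :: "complex vec" assume x: "x \<in> carrier_vec n"
    define y where "y = mat_adjoint U *\<^sub>v x"
    have y: "y \<in> carrier_vec n" using Ua x by (auto simp: y_def)
    have Uy: "U *\<^sub>v y = x"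
      unfolding y_def using assoc_mult_mat_vec[OF U Ua x] x by (simp add: UU')
    have "x \<bullet>c x = y \<bullet>c y"
      using move[OF x y] by (simp only: Uy y_def[symmetric])
    then show "Re (x \<bullet>c x) = (\<Sum>i<n. (cmod ((mat_adjoint U *\<^sub>v x) $ i))\<^sup>2)"
      unfolding y_def[symmetric] using inner_self[OF y] by simp
    have "expect X x = (mat_adjoint U *\<^sub>v (X *\<^sub>v (U *\<^sub>v y))) \<bullet>c y"
      using move[of "X *\<^sub>v x" y] X x y by (simp add: expect_def Uy)
    also have "mat_adjoint U *\<^sub>v (X *\<^sub>v (U *\<^sub>v y)) = mat_diag n (\<lambda>i. ?es ! i) *\<^sub>v y"
      unfolding D[symmetric] using U Ua X y by (simp add: assoc_mult_mat_vec[of _ n n _ n])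
    also have "\<dots> \<bullet>c y = (\<Sum>i<n. ?es ! i * y $ i * cnj (y $ i))"
      using y
      by (auto simp: scalar_prod_def mat_diag_def atLeast0LessThan if_distrib[of "\<lambda>c. c * _"]
            cong: if_cong intro!: sum.cong)
    also have "\<dots> = (\<Sum>i<n. of_real (sorted_eigvals X ! i * (cmod (y $ i))\<^sup>2))"
      using length_sorted_eigvals[OF X]
      by (intro sum.cong)
        (auto simp: complex_norm_square mult.assoc simp del: of_real_power)
    finally show "Re (expect X x)
        = (\<Sum>i<n. sorted_eigvals X ! i * (cmod ((mat_adjoint U *\<^sub>v x) $ i))\<^sup>2)"
      unfolding y_def[symmetric] by simp
  qed
qed

section \<open>Dimension counting and Courant-Fischer bounds\<close>

lemma underdetermined_kernel:
  fixes A :: "complex mat"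
  assumes "A \<in> carrier_mat r m" "r < m"
  obtains s where "s \<in> carrier_vec m" "s \<noteq> 0\<^sub>v m" "A *\<^sub>v s = 0\<^sub>v r"
proof -
  \<comment> \<open>Padding with zero rows makes the matrix square. Row \<open>r\<close> of
    \<open>B\<close> is zero, so the transpose kills \<open>unit_vec m r\<close>; hence both
    determinants vanish and \<open>B\<close> has a kernel vector, which \<open>A\<close> annihilates
    too.\<close>
  define B where "B = mat m m (\<lambda>(i, j). if i < r then A $$ (i, j) else 0)"
  have B: "B \<in> carrier_mat m m" by (simp add: B_def)
  have Bt: "transpose_mat B \<in> carrier_mat m m" using B by simp
  have "transpose_mat B *\<^sub>v unit_vec m r = 0\<^sub>v m"
    using assms by (intro eq_vecI) (auto simp: B_def)
  moreover have "unit_vec m r \<noteq> (0\<^sub>v m :: complex vec)"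
    using assms(2) by (metis index_unit_vec(2) index_zero_vec(1) one_neq_zero)
  ultimately have "det (transpose_mat B) = 0"
    using det_0_iff_vec_prod_zero[OF Bt]
      unit_vec_carrier[of m r] by blast
  then obtain s where s: "s \<in> carrier_vec m" "s \<noteq> 0\<^sub>v m" "B *\<^sub>v s = 0\<^sub>v m"
    using det_transpose[OF B] det_0_iff_vec_prod_zero[OF B] by auto
  have "A *\<^sub>v s = 0\<^sub>v r"
  proof (rule eq_vecI)
    fix i assume "i < dim_vec (0\<^sub>v r :: complex vec)"
    then have i: "i < r" by simp
    have "row A i = row B i"
      using assms i by (intro eq_vecI) (auto simp: B_def)
    then have "(A *\<^sub>v s) $ i = (B *\<^sub>v s) $ i"
      using i assms B by simp
    then show "(A *\<^sub>v s) $ i = 0\<^sub>v r $ i"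
      using s(3) i assms(2) by simp
  qed (use assms in auto)
  then show thesis using that s by blast
qed

text \<open>The \<open>c\<close> equations of \<open>C\<close> and the \<open>r\<close> equations
  for the coordinates are stacked into one system of fewer than \<open>m\<close> equations in
  \<open>m\<close> unknowns. The selector \<open>p\<close> lets the same count clear either the
  lowest or the highest eigencoordinates.\<close>

lemma subspace_coordinates_vanish:
  fixes U L C :: "complex mat"
  assumes U: "U \<in> carrier_mat n n" and L: "L \<in> carrier_mat n m" and C: "C \<in> carrier_mat c m"
    and "c + r < m" and p: "\<And>i. i < r \<Longrightarrow> p i < n"
  obtains s where "s \<in> carrier_vec m" "s \<noteq> 0\<^sub>v m" "C *\<^sub>v s = 0\<^sub>v c"
    "\<forall>i<r. (mat_adjoint U *\<^sub>v (L *\<^sub>v s)) $ p i = 0"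
proof -
  let ?V = "mat_adjoint U * L"
  define A where "A = mat (r + c) m (\<lambda>(i, j). if i < r then ?V $$ (p i, j) else C $$ (i - r, j))"
  have A: "A \<in> carrier_mat (r + c) m" by (simp add: A_def)
  obtain s where s: "s \<in> carrier_vec m" "s \<noteq> 0\<^sub>v m" "A *\<^sub>v s = 0\<^sub>v (r + c)"
    using underdetermined_kernel[OF A] assms(4) by (auto simp: add.commute)
  have V: "?V \<in> carrier_mat n m"
    using adjoint_carrier[OF U] L by auto
  have "C *\<^sub>v s = 0\<^sub>v c"
  proof (rule eq_vecI)
    fix i assume "i < dim_vec (0\<^sub>v c :: complex vec)"
    then have i: "i < c" by simp
    have "row C i = row A (r + i)"
      using C i by (intro eq_vecI) (auto simp: A_def)
    then have "(C *\<^sub>v s) $ i = (A *\<^sub>v s) $ (r + i)"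
      using i C A by simp
    then show "(C *\<^sub>v s) $ i = 0\<^sub>v c $ i"
      using s(3) i by simp
  qed (use C in auto)
  moreover have "(mat_adjoint U *\<^sub>v (L *\<^sub>v s)) $ p i = 0" if i: "i < r" for i
  proof -
    have "row ?V (p i) = row A i"
      using U L V i p[OF i] by (intro eq_vecI) (auto simp: A_def)
    then have "(?V *\<^sub>v s) $ p i = (A *\<^sub>v s) $ i"
      using i V A p[OF i] by (simp del: row_mult index_mult_mat(2))
    then show ?thesis
      using s(3) i assoc_mult_mat_vec[OF adjoint_carrier[OF U] L s(1)] by simp
  qed
  ultimately show thesis using that s by blast
qed

lemma sorted_eigvals_mono:
  assumes "X \<in> carrier_mat n n" "i \<le> j" "j < n"
  shows "sorted_eigvals X ! i \<le> sorted_eigvals X ! j"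
proof -
  have "sorted (sorted_eigvals X)" by (simp add: sorted_eigvals_def)
  then show ?thesis
    using assms length_sorted_eigvals[OF assms(1)] by (simp add: sorted_nth_mono)
qed

text \<open>In the two bounds below the test space is the image under \<open>L\<close> of the kernel of \<open>C\<close>.\<close>

lemma eigval_le:
  fixes X L C :: "complex mat"
  assumes X: "hermitian X" "X \<in> carrier_mat n n"
    and L: "L \<in> carrier_mat n m" and C: "C \<in> carrier_mat c m"
    and k: "1 \<le> k" "k \<le> n" "c + k \<le> m"
    and test: "\<And>s. s \<in> carrier_vec m \<Longrightarrow> s \<noteq> 0\<^sub>v m \<Longrightarrow> C *\<^sub>v s = 0\<^sub>v c \<Longrightarrow>
      L *\<^sub>v s \<noteq> 0\<^sub>v n \<and> Re (expect X (L *\<^sub>v s)) \<le> \<mu> * Re ((L *\<^sub>v s) \<bullet>c (L *\<^sub>v s))"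
  shows "eigval k X \<le> \<mu>"
proof -
  obtain U where U: "U \<in> carrier_mat n n"
    and E: "\<forall>x \<in> carrier_vec n.
       Re (expect X x) = (\<Sum>i<n. sorted_eigvals X ! i * (cmod ((mat_adjoint U *\<^sub>v x) $ i))\<^sup>2)"
    and N: "\<forall>x \<in> carrier_vec n.
       Re (x \<bullet>c x) = (\<Sum>i<n. (cmod ((mat_adjoint U *\<^sub>v x) $ i))\<^sup>2)"
    using hermitian_coordinates[OF X] by blast
  \<comment> \<open>The kernel of \<open>C\<close> has dimension at least \<open>k\<close>, so it is
    large enough to clear the \<open>k - 1\<close> coordinates with the smallest weights.\<close>
  have 1: "c + (k - 1) < m" and 2: "\<And>i. i < k - 1 \<Longrightarrow> i < n"
    using k by linarith+
  obtain s where s: "s \<in> carrier_vec m" "s \<noteq> 0\<^sub>v m" "C *\<^sub>v s = 0\<^sub>v c"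
    and z: "\<forall>i<k - 1. (mat_adjoint U *\<^sub>v (L *\<^sub>v s)) $ i = 0"
    using subspace_coordinates_vanish[where p = "\<lambda>i. i", OF U L C 1 2] by blast
  define x where "x = L *\<^sub>v s"
  have x: "x \<in> carrier_vec n" "x \<noteq> 0\<^sub>v n" "Re (expect X x) \<le> \<mu> * Re (x \<bullet>c x)"
    using test[OF s] L s by (auto simp: x_def)
  \<comment> \<open>Every surviving weight is at least \<open>sorted_eigvals X ! (k - 1)\<close>,
    which is \<open>eigval k X\<close> because eigenvalues are counted from 1.\<close>
  have "eigval k X * Re (x \<bullet>c x) \<le> Re (expect X x)"
    unfolding bspec[OF E x(1)] bspec[OF N x(1)] sum_distrib_left
  proof (intro sum_mono)
    fix i assume "i \<in> {..<n}"
    then show "eigval k X * (cmod ((mat_adjoint U *\<^sub>v x) $ i))\<^sup>2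
        \<le> sorted_eigvals X ! i * (cmod ((mat_adjoint U *\<^sub>v x) $ i))\<^sup>2"
      using z sorted_eigvals_mono[OF X(2), of "k - 1" i]
      by (cases "i < k - 1") (auto simp: x_def eigval_def intro!: mult_right_mono)
  qed
  then have "eigval k X * Re (x \<bullet>c x) \<le> \<mu> * Re (x \<bullet>c x)"
    using x(3) by linarith
  then show ?thesis
    using inner_self_pos[OF x(1,2)] by simp
qed

lemma eigval_ge:
  fixes X L C :: "complex mat"
  assumes X: "hermitian X" "X \<in> carrier_mat n n"
    and L: "L \<in> carrier_mat n m" and C: "C \<in> carrier_mat c m"
    and d: "1 \<le> d" "d \<le> n" "c + d \<le> m"
    and test: "\<And>s. s \<in> carrier_vec m \<Longrightarrow> s \<noteq> 0\<^sub>v m \<Longrightarrow> C *\<^sub>v s = 0\<^sub>v c \<Longrightarrow>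
      L *\<^sub>v s \<noteq> 0\<^sub>v n \<and> \<mu> * Re ((L *\<^sub>v s) \<bullet>c (L *\<^sub>v s)) \<le> Re (expect X (L *\<^sub>v s))"
  shows "\<mu> \<le> eigval (n + 1 - d) X"
proof -
  obtain U where U: "U \<in> carrier_mat n n"
    and E: "\<forall>x \<in> carrier_vec n.
       Re (expect X x) = (\<Sum>i<n. sorted_eigvals X ! i * (cmod ((mat_adjoint U *\<^sub>v x) $ i))\<^sup>2)"
    and N: "\<forall>x \<in> carrier_vec n.
       Re (x \<bullet>c x) = (\<Sum>i<n. (cmod ((mat_adjoint U *\<^sub>v x) $ i))\<^sup>2)"
    using hermitian_coordinates[OF X] by blast
  \<comment> \<open>Here the \<open>d - 1\<close> coordinates with the largest weights are cleared.
    The last surviving position is \<open>n - d\<close>, and this is where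
    \<open>eigval (n + 1 - d) X\<close> sits.\<close>
  have 1: "c + (d - 1) < m" and 2: "\<And>i. i < d - 1 \<Longrightarrow> n - 1 - i < n"
    using d by linarith+
  obtain s where s: "s \<in> carrier_vec m" "s \<noteq> 0\<^sub>v m" "C *\<^sub>v s = 0\<^sub>v c"
    and z: "\<forall>i<d - 1. (mat_adjoint U *\<^sub>v (L *\<^sub>v s)) $ (n - 1 - i) = 0"
    using subspace_coordinates_vanish[where p = "\<lambda>i. n - 1 - i", OF U L C 1 2] by blast
  define x where "x = L *\<^sub>v s"
  have x: "x \<in> carrier_vec n" "x \<noteq> 0\<^sub>v n" "\<mu> * Re (x \<bullet>c x) \<le> Re (expect X x)"
    using test[OF s] L s by (auto simp: x_def)
  have "Re (expect X x) \<le> eigval (n + 1 - d) X * Re (x \<bullet>c x)"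
    unfolding bspec[OF E x(1)] bspec[OF N x(1)] sum_distrib_left
  proof (intro sum_mono)
    fix i assume i: "i \<in> {..<n}"
    show "sorted_eigvals X ! i * (cmod ((mat_adjoint U *\<^sub>v x) $ i))\<^sup>2
        \<le> eigval (n + 1 - d) X * (cmod ((mat_adjoint U *\<^sub>v x) $ i))\<^sup>2"
    proof (cases "i \<le> n - d")
      case True
      then show ?thesis
        using sorted_eigvals_mono[OF X(2), of i "n - d"] d
        by (auto simp: eigval_def intro!: mult_right_mono)
    next
      case False
      then have "(mat_adjoint U *\<^sub>v x) $ i = 0"
        using spec[OF z, of "n - 1 - i"] i d by (simp add: x_def)
      then show ?thesis by simp
    qed
  qed
  then have "\<mu> * Re (x \<bullet>c x) \<le> eigval (n + 1 - d) X * Re (x \<bullet>c x)"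
    using x(3) by linarith
  then show ?thesis
    using inner_self_pos[OF x(1,2)] by simp
qed

section \<open>Coordinates and norms of product vectors\<close>

lemma tensor_carrier [intro]:
  "u \<in> carrier_vec K \<Longrightarrow> v \<in> carrier_vec M \<Longrightarrow> tensor_vec u v \<in> carrier_vec (K * M)"
  by (auto simp: tensor_vec_def)

lemma tensor_index:
  "u \<in> carrier_vec K \<Longrightarrow> v \<in> carrier_vec M \<Longrightarrow> i < K * M \<Longrightarrow>
    tensor_vec u v $ i = u $ (i div M) * v $ (i mod M)"
  by (auto simp: tensor_vec_def)

lemma tensor_index_less:
  fixes i K M :: nat
  assumes "i < K * M"
  shows "i div M < K" "i mod M < M"
  using assms by (auto simp: less_mult_imp_div_less intro!: mod_less_divisor gr0I)

lemma tensor_index_combine: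
  fixes i j K M :: nat
  assumes "i < K" "j < M"
  shows "i * M + j < K * M" "(i * M + j) div M = i" "(i * M + j) mod M = j"
proof -
  have "i * M + j < (i + 1) * M" using assms by simp
  also have "\<dots> \<le> K * M" using assms by (intro mult_right_mono) auto
  finally show "i * M + j < K * M" .
qed (use assms in auto)

lemma sum_tensor_index:
  fixes f :: "nat \<Rightarrow> nat \<Rightarrow> 'a :: comm_monoid_add"
  shows "(\<Sum>i<K * M. f (i div M) (i mod M)) = (\<Sum>i<K. \<Sum>j<M. f i j)"
  unfolding sum.cartesian_product
  by (rule sum.reindex_bij_witness[of _ "\<lambda>(i, j). i * M + j" "\<lambda>i. (i div M, i mod M)"])
    (auto simp: tensor_index_less tensor_index_combine)

lemma tensor_inner_self:
  assumes "u \<in> carrier_vec K" "v \<in> carrier_vec M"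
  shows "tensor_vec u v \<bullet>c tensor_vec u v = (u \<bullet>c u) * (v \<bullet>c v)"
proof -
  have "tensor_vec u v \<bullet>c tensor_vec u v = (\<Sum>i<K * M.
      u $ (i div M) * v $ (i mod M) * cnj (u $ (i div M) * v $ (i mod M)))"
    using assms tensor_carrier[OF assms]
    by (auto simp: scalar_prod_def atLeast0LessThan tensor_index intro!: sum.cong)
  also have "\<dots> = (\<Sum>i<K. \<Sum>j<M. u $ i * v $ j * cnj (u $ i * v $ j))"
    by (rule sum_tensor_index)
  also have "\<dots> = (u \<bullet>c u) * (v \<bullet>c v)"
    using assms
    by (auto simp: scalar_prod_def atLeast0LessThan sum_product mult_ac intro!: sum.cong)
  finally show ?thesis .
qed

lemma tensor_smult:
  assumes "u \<in> carrier_vec K" "v \<in> carrier_vec M"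
  shows "tensor_vec (\<alpha> \<cdot>\<^sub>v u) (\<beta> \<cdot>\<^sub>v v) = (\<alpha> * \<beta>) \<cdot>\<^sub>v tensor_vec u v"
  using assms tensor_index_less[of _ K M] by (intro eq_vecI) (auto simp: tensor_vec_def)

section \<open>The tangent space at a maximizing product vector\<close>

lemma expect_smult:
  assumes "X \<in> carrier_mat n n" "x \<in> carrier_vec n"
  shows "expect X (\<alpha> \<cdot>\<^sub>v x) = of_real ((cmod \<alpha>)\<^sup>2) * expect X x"
  using assms
  by (simp add: expect_def mult_mat_vec conjugate_smult_vec complex_norm_square
        del: of_real_power)

text \<open>The cross terms cancel between \<open>x + y\<close> and \<open>x - y\<close>. Used at
  two levels, this identity replaces an average over all phases by one over four of them.\<close>

lemma expect_parallelogram: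
  assumes "X \<in> carrier_mat n n" "x \<in> carrier_vec n" "y \<in> carrier_vec n"
  shows "expect X (x + y) + expect X (x - y) = 2 * expect X x + 2 * expect X y"
proof -
  have x: "x + y \<in> carrier_vec n" "x - y \<in> carrier_vec n" using assms by auto
  show ?thesis
    unfolding expect_sum[OF assms(1) x(1)] expect_sum[OF assms(1) x(2)]
      expect_sum[OF assms(1,2)] expect_sum[OF assms(1,3)]
      sum_distrib_left sum_distrib_right sum.distrib[symmetric]
    using assms by (intro sum.cong) (auto simp: algebra_simps)
qed

lemma unit_vec_normalize:
  assumes "p \<in> carrier_vec n" "p \<noteq> 0\<^sub>v n"
  obtains r q where "q \<in> unit_vecs n" "p = complex_of_real r \<cdot>\<^sub>v q"
proof
  define s where "s = Re (p \<bullet>c p)"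
  have s: "s > 0" "p \<bullet>c p = of_real s"
    using inner_self_pos[OF assms] inner_self[OF assms(1)] by (auto simp: s_def)
  let ?q = "complex_of_real (1 / sqrt s) \<cdot>\<^sub>v p"
  have "?q \<bullet>c ?q = of_real (1 / sqrt s) * of_real (1 / sqrt s) * of_real s"
    using assms(1) unfolding s(2)[symmetric] by (simp add: conjugate_smult_vec)
  also have "\<dots> = of_real (1 / sqrt s * (1 / sqrt s) * s)"
    unfolding of_real_mult ..
  also have "\<dots> = 1"
    using s(1) by simp
  finally show "?q \<in> unit_vecs n"
    using assms(1) by (simp add: unit_vecs_def)
  show "p = complex_of_real (sqrt s) \<cdot>\<^sub>v ?q"
    using s(1) by (simp add: smult_smult_assoc flip: of_real_mult)
qed

text \<open>Both sides scale by the same squared factor, so the bound on unit product vectors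
  extends to all of them; a zero factor cannot be normalized and is treated apart.\<close>

lemma expect_tensor_le:
  assumes X: "X \<in> carrier_mat (K * M) (K * M)" and "K > 0" "M > 0"
    and p: "p \<in> carrier_vec K" and q: "q \<in> carrier_vec M"
  shows "Re (expect X (tensor_vec p q))
      \<le> lambda_max_prod K M X * Re (tensor_vec p q \<bullet>c tensor_vec p q)"
proof (cases "p = 0\<^sub>v K \<or> q = 0\<^sub>v M")
  case True
  then have "tensor_vec p q = 0\<^sub>v (K * M)"
    using p q tensor_index_less[of _ K M] by (intro eq_vecI) (auto simp: tensor_vec_def)
  then show ?thesis using X by (simp add: expect_def)
next
  case False
  obtain r p' where p': "p' \<in> unit_vecs K" "p = complex_of_real r \<cdot>\<^sub>v p'"
    using unit_vec_normalize[OF p] False by metis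
  obtain t q' where q': "q' \<in> unit_vecs M" "q = complex_of_real t \<cdot>\<^sub>v q'"
    using unit_vec_normalize[OF q] False by metis
  have c: "p' \<in> carrier_vec K" "q' \<in> carrier_vec M"
    using p' q' by (auto simp: unit_vecs_def)
  define w where "w = tensor_vec p' q'"
  have w: "w \<in> carrier_vec (K * M)" "w \<bullet>c w = 1"
    using tensor_inner_self[OF c] tensor_carrier[OF c] p' q' by (auto simp: w_def unit_vecs_def)
  have pq: "tensor_vec p q = complex_of_real (r * t) \<cdot>\<^sub>v w"
    unfolding p'(2) q'(2) w_def using tensor_smult[OF c] by simp
  have E: "Re (expect X (tensor_vec p q)) = (r * t)\<^sup>2 * Re (expect X w)"
    unfolding pq expect_smult[OF X w(1)] norm_of_real power2_abs by simp
  have "Re (tensor_vec p q \<bullet>c tensor_vec p q) = (r * t)\<^sup>2"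
    unfolding pq using w by (simp add: conjugate_smult_vec power2_eq_square)
  moreover have "Re (expect X w) \<le> lambda_max_prod K M X"
    using p' q' by (intro product_values_max(2)[OF assms(1-3)])
      (auto simp: product_values_def w_def)
  ultimately show ?thesis
    unfolding E by (simp add: mult_right_mono mult.commute[of "(r * t)\<^sup>2"])
qed

text \<open>Averaging the form over the product vectors \<open>(a + \<tau> u) \<otimes> (b + \<tau> v)\<close> with
  \<open>\<tau> \<in> {t, - t, \<i> t, - \<i> t}\<close> removes all cross terms and leaves
  \<open>Q (a \<otimes> b) + t\<^sup>2 Q (u \<otimes> b + a \<otimes> v) + t\<^sup>4 Q (u \<otimes> v)\<close>.\<close>

lemma expect_tangent_le:
  fixes X :: "complex mat"
  assumes X: "X \<in> carrier_mat (K * M) (K * M)"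
    and neg: "\<And>p q. p \<in> carrier_vec K \<Longrightarrow> q \<in> carrier_vec M \<Longrightarrow>
      Re (expect X (tensor_vec p q)) \<le> 0"
    and ab: "a \<in> carrier_vec K" "b \<in> carrier_vec M" and zero: "Re (expect X (tensor_vec a b)) = 0"
    and uv: "u \<in> carrier_vec K" "v \<in> carrier_vec M"
  shows "Re (expect X (tensor_vec u b + tensor_vec a v)) \<le> 0"
proof (rule ccontr)
  define Q where "Q x = Re (expect X x)" for x
  define c w z where "c = tensor_vec a b" "w = tensor_vec u b + tensor_vec a v"
    "z = tensor_vec u v"
  have car: "c \<in> carrier_vec (K * M)" "w \<in> carrier_vec (K * M)" "z \<in> carrier_vec (K * M)"
    using ab uv unfolding c_w_z_def by (blast intro: add_carrier_vec)+
  assume "\<not> Re (expect X (tensor_vec u b + tensor_vec a v)) \<le> 0"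
  then have Qw: "Q w > 0" by (simp add: Q_def c_w_z_def)
  have Qz: "Q z \<le> 0" using neg uv by (simp add: Q_def c_w_z_def)
  \<comment> \<open>The curve \<open>c + \<tau> w + \<tau>\<^sup>2 z\<close> consists of product
    vectors. It is bracketed so that replacing \<tau> by its negative flips only the
    \<open>w\<close> term.\<close>
  have psi: "Q ((c + \<tau>\<^sup>2 \<cdot>\<^sub>v z) + \<tau> \<cdot>\<^sub>v w) \<le> 0" for \<tau>
  proof -
    have "(c + \<tau>\<^sup>2 \<cdot>\<^sub>v z) + \<tau> \<cdot>\<^sub>v w = tensor_vec (a + \<tau> \<cdot>\<^sub>v u) (b + \<tau> \<cdot>\<^sub>v v)"
      using ab uv tensor_index_less[of _ K M]
      by (intro eq_vecI) (auto simp: c_w_z_def tensor_vec_def algebra_simps power2_eq_square)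
    then show ?thesis using neg ab uv by (simp add: Q_def)
  qed
  have par: "Q (x + y) + Q (x - y) = 2 * Q x + 2 * Q y"
    if "x \<in> carrier_vec (K * M)" "y \<in> carrier_vec (K * M)" for x y
    using arg_cong[OF expect_parallelogram[OF X that], of Re] by (simp add: Q_def)
  have sm: "Q (\<alpha> \<cdot>\<^sub>v x) = (cmod \<alpha>)\<^sup>2 * Q x" if "x \<in> carrier_vec (K * M)" for \<alpha> x
    by (simp add: Q_def expect_smult[OF X that])
  have pair: "2 * Q (c + \<tau>\<^sup>2 \<cdot>\<^sub>v z) + 2 * ((cmod \<tau>)\<^sup>2 * Q w) \<le> 0" for \<tau>
  proof -
    have "(c + (- \<tau>)\<^sup>2 \<cdot>\<^sub>v z) + (- \<tau>) \<cdot>\<^sub>v w = (c + \<tau>\<^sup>2 \<cdot>\<^sub>v z) - \<tau> \<cdot>\<^sub>v w"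
      using car by (intro eq_vecI) auto
    then have "Q ((c + \<tau>\<^sup>2 \<cdot>\<^sub>v z) - \<tau> \<cdot>\<^sub>v w) \<le> 0"
      using psi[of "- \<tau>"] by simp
    moreover have "Q ((c + \<tau>\<^sup>2 \<cdot>\<^sub>v z) + \<tau> \<cdot>\<^sub>v w) + Q ((c + \<tau>\<^sup>2 \<cdot>\<^sub>v z) - \<tau> \<cdot>\<^sub>v w)
        = 2 * Q (c + \<tau>\<^sup>2 \<cdot>\<^sub>v z) + 2 * Q (\<tau> \<cdot>\<^sub>v w)"
      using car by (intro par) auto
    ultimately show ?thesis using psi[of \<tau>] sm[OF car(2), of \<tau>] by linarith
  qed
  \<comment> \<open>With this choice \<open>Q w + t\<^sup>2 * Q z\<close> equals
    \<open>Q w / (1 - Q z)\<close>. As \<open>Q z\<close> is nonpositive and \<open>Q w\<close>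
    positive, this is positive, against the averaged inequality.\<close>
  define t where "t = sqrt (Q w / (1 - Q z))"
  have t2: "t\<^sup>2 = Q w / (1 - Q z)" and t0: "t\<^sup>2 > 0"
    using Qw Qz by (auto simp: t_def)
  \<comment> \<open>The phase \<open>\<i>\<close> keeps the modulus but negates the square, so the
    sum with the case of real \<open>t\<close> removes the cross term between \<open>c\<close> and
    \<open>z\<close>.\<close>
  have "c + (\<i> * complex_of_real t)\<^sup>2 \<cdot>\<^sub>v z = c - (complex_of_real t)\<^sup>2 \<cdot>\<^sub>v z"
    using car by (intro eq_vecI) (auto simp: power_mult_distrib)
  then have "2 * Q (c - (complex_of_real t)\<^sup>2 \<cdot>\<^sub>v z) + 2 * (t\<^sup>2 * Q w) \<le> 0"
    using pair[of "\<i> * complex_of_real t"] by (simp add: norm_mult)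
  moreover have "2 * Q (c + (complex_of_real t)\<^sup>2 \<cdot>\<^sub>v z) + 2 * (t\<^sup>2 * Q w) \<le> 0"
    using pair[of "complex_of_real t"] by simp
  moreover have "Q (c + (complex_of_real t)\<^sup>2 \<cdot>\<^sub>v z) + Q (c - (complex_of_real t)\<^sup>2 \<cdot>\<^sub>v z)
      = 2 * Q c + 2 * Q ((complex_of_real t)\<^sup>2 \<cdot>\<^sub>v z)"
    using car by (intro par) auto
  moreover have "Q ((complex_of_real t)\<^sup>2 \<cdot>\<^sub>v z) = (t\<^sup>2)\<^sup>2 * Q z"
    using sm[OF car(3)] by (simp add: norm_power)
  moreover have "Q c = 0" using zero by (simp add: Q_def c_w_z_def)
  ultimately have "t\<^sup>2 * (Q w + t\<^sup>2 * Q z) \<le> 0"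
    by (simp add: power2_eq_square algebra_simps)
  then have "Q w + t\<^sup>2 * Q z \<le> 0"
    using t0 by (simp add: mult_le_0_iff)
  moreover have "Q w + t\<^sup>2 * Q z = Q w / (1 - Q z)"
    using Qz by (simp add: t2 field_simps)
  ultimately show False
    using Qw Qz by (simp add: divide_le_0_iff)
qed

text \<open>\<open>L\<close> maps a pair \<open>(u, v)\<close> to
  \<open>u \<otimes> b + a \<otimes> v\<close>. On all pairs it has a one-dimensional kernel,
  spanned by \<open>(a, - b)\<close>; the single equation \<open>C\<close>, which says that
  \<open>v\<close> is orthogonal to \<open>b\<close>, removes it. So \<open>K + M - 1\<close>
  dimensions remain on which \<open>L\<close> is injective.\<close>

lemma max_tangent_space:
  assumes X: "X \<in> carrier_mat (K * M) (K * M)" and pos: "K > 0" "M > 0"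
  obtains L C where "L \<in> carrier_mat (K * M) (K + M)" "C \<in> carrier_mat 1 (K + M)"
    "\<forall>s \<in> carrier_vec (K + M). s \<noteq> 0\<^sub>v (K + M) \<and> C *\<^sub>v s = 0\<^sub>v 1 \<longrightarrow>
      L *\<^sub>v s \<noteq> 0\<^sub>v (K * M) \<and>
      Re (expect X (L *\<^sub>v s)) \<le> lambda_max_prod K M X * Re ((L *\<^sub>v s) \<bullet>c (L *\<^sub>v s))"
proof -
  let ?n = "K * M" and ?\<mu> = "lambda_max_prod K M X"
  obtain a b where "a \<in> unit_vecs K" "b \<in> unit_vecs M"
    and max: "?\<mu> = Re (expect X (tensor_vec a b))"
    using product_values_max(1)[OF X pos] by (auto simp: product_values_def)
  then have a: "a \<in> carrier_vec K" "a \<bullet>c a = 1" and b: "b \<in> carrier_vec M" "b \<bullet>c b = 1"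
    by (auto simp: unit_vecs_def)
  define Y where "Y = X + (- complex_of_real ?\<mu>) \<cdot>\<^sub>m 1\<^sub>m ?n"
  have Y: "Y \<in> carrier_mat ?n ?n" using X by (simp add: Y_def)
  have EY: "Re (expect Y x) = Re (expect X x) - ?\<mu> * Re (x \<bullet>c x)"
    if x: "x \<in> carrier_vec ?n" for x
  proof -
    have Yx: "Y *\<^sub>v x = X *\<^sub>v x + (- complex_of_real ?\<mu>) \<cdot>\<^sub>v x"
      using X x by (intro eq_vecI)
        (auto simp: Y_def add_scalar_prod_distrib[of _ ?n] smult_scalar_prod_distrib[of _ ?n])
    have "expect Y x = expect X x - of_real ?\<mu> * (x \<bullet>c x)"
      unfolding expect_def Yx using X x by (subst add_scalar_prod_distrib[of _ ?n]) auto
    then show ?thesis by simp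
  qed
  have neg: "Re (expect Y (tensor_vec p q)) \<le> 0"
    if "p \<in> carrier_vec K" "q \<in> carrier_vec M" for p q
    using EY[OF tensor_carrier[OF that]] expect_tensor_le[OF X pos that] by simp
  have zero: "Re (expect Y (tensor_vec a b)) = 0"
    using EY[OF tensor_carrier[OF a(1) b(1)]] tensor_inner_self[OF a(1) b(1)] a b max by simp
  define L where "L = mat ?n (K + M) (\<lambda>(i, j).
    if j < K then (if j = i div M then b $ (i mod M) else 0)
    else (if j = K + i mod M then a $ (i div M) else 0))"
  define C where "C = mat 1 (K + M) (\<lambda>(i, j). if j < K then 0 else cnj (b $ (j - K)))"
  have sum_split: "(\<Sum>j<K + M. f j) = (\<Sum>j<K. f j) + (\<Sum>j<M. f (K + j))"
    for f :: "nat \<Rightarrow> complex"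
    using sum.atLeastLessThan_concat[of 0 K "K + M" f] sum.shift_bounds_nat_ivl[of f 0 K M]
    by (simp add: atLeast0LessThan add.commute)
  show thesis
  proof (rule that[of L C]; (intro ballI impI)?)
    show "L \<in> carrier_mat ?n (K + M)" "C \<in> carrier_mat 1 (K + M)"
      by (auto simp: L_def C_def)
    fix s :: "complex vec"
    assume "s \<in> carrier_vec (K + M)" "s \<noteq> 0\<^sub>v (K + M) \<and> C *\<^sub>v s = 0\<^sub>v 1"
    then have s: "s \<in> carrier_vec (K + M)" "s \<noteq> 0\<^sub>v (K + M)" "C *\<^sub>v s = 0\<^sub>v 1" by auto
    define u v where "u = vec K (\<lambda>i. s $ i)" "v = vec M (\<lambda>j. s $ (K + j))"
    have uv: "u \<in> carrier_vec K" "v \<in> carrier_vec M" by (auto simp: u_v_def)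
    have Ls_index: "(L *\<^sub>v s) $ i = u $ (i div M) * b $ (i mod M) + a $ (i div M) * v $ (i mod M)"
      if i: "i < ?n" for i
    proof -
      note lt = tensor_index_less[OF i]
      have "(L *\<^sub>v s) $ i = (\<Sum>j<K + M. L $$ (i, j) * s $ j)"
        using s i by (auto simp: scalar_prod_def atLeast0LessThan L_def intro!: sum.cong)
      also have "\<dots> = (\<Sum>j<K. if j = i div M then b $ (i mod M) * s $ j else 0)
          + (\<Sum>j<M. if j = i mod M then a $ (i div M) * s $ (K + j) else 0)"
        unfolding sum_split using i by (intro arg_cong2[of _ _ _ _ "(+)"] sum.cong) (auto simp: L_def)
      also have "\<dots> = u $ (i div M) * b $ (i mod M) + a $ (i div M) * v $ (i mod M)"
        using lt by (simp add: u_v_def)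
      finally show ?thesis .
    qed
    have Ls: "L *\<^sub>v s = tensor_vec u b + tensor_vec a v"
      using a b uv Ls_index by (intro eq_vecI) (auto simp: tensor_index L_def tensor_vec_def)
    have "(C *\<^sub>v s) $ 0 = (\<Sum>j<K + M. C $$ (0, j) * s $ j)"
      using s(1) by (auto simp: scalar_prod_def atLeast0LessThan C_def intro!: sum.cong)
    also have "\<dots> = (\<Sum>j<M. cnj (b $ j) * v $ j)"
      unfolding sum_split by (simp add: C_def u_v_def)
    finally have orth: "(\<Sum>j<M. cnj (b $ j) * v $ j) = 0"
      using s(3) by simp
    have "L *\<^sub>v s \<noteq> 0\<^sub>v ?n"
    proof
      assume Ls0: "L *\<^sub>v s = 0\<^sub>v ?n"
      have prod0: "u $ i * b $ j + a $ i * v $ j = 0" if "i < K" "j < M" for i j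
        using Ls_index[of "i * M + j"] tensor_index_combine[OF that] Ls0 by simp
      \<comment> \<open>Pairing the relation with the conjugate of \<open>b\<close> isolates
        \<open>u $ i\<close>, because \<open>b\<close> is a unit vector orthogonal to
        \<open>v\<close>. A nonzero coordinate of \<open>a\<close> then forces
        \<open>v = 0\<close>.\<close>
      have u0: "u $ i = 0" if i: "i < K" for i
      proof -
        have "0 = (\<Sum>j<M. cnj (b $ j) * (u $ i * b $ j + a $ i * v $ j))"
          using prod0[OF i] by simp
        also have "\<dots> = u $ i * (b \<bullet>c b) + a $ i * (\<Sum>j<M. cnj (b $ j) * v $ j)"
          using b(1) by (simp add: scalar_prod_def atLeast0LessThan sum_distrib_left
              sum.distrib algebra_simps)
        finally show ?thesis using b(2) orth by simp
      qed
      have "a \<noteq> 0\<^sub>v K" using a by auto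
      then obtain i where i: "i < K" "a $ i \<noteq> 0"
        using a(1) by (metis carrier_vecD eq_vecI index_zero_vec)
      then have v0: "v $ j = 0" if "j < M" for j
        using prod0[OF i(1) that] u0[OF i(1)] by simp
      have "s $ j = 0" if "j < K + M" for j
        using u0[of j] v0[of "j - K"] that by (cases "j < K") (auto simp: u_v_def)
      then have "s = 0\<^sub>v (K + M)"
        using s(1) by (intro eq_vecI) auto
      with s(2) show False ..
    qed
    moreover have "Re (expect X (L *\<^sub>v s)) \<le> ?\<mu> * Re ((L *\<^sub>v s) \<bullet>c (L *\<^sub>v s))"
      using expect_tangent_le[OF Y neg a(1) b(1) zero uv] EY[of "L *\<^sub>v s"] a b uv
      unfolding Ls by (auto simp: tensor_carrier)
    ultimately show "L *\<^sub>v s \<noteq> 0\<^sub>v ?n \<and>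
        Re (expect X (L *\<^sub>v s)) \<le> ?\<mu> * Re ((L *\<^sub>v s) \<bullet>c (L *\<^sub>v s))" ..
  qed
qed

section \<open>Sign change, exchanging maximum and minimum\<close>

lemma hermitian_uminus:
  assumes "hermitian X" "X \<in> carrier_mat n n"
  shows "hermitian (- X)"
  unfolding hermitian_def
  by (rule eq_matI) (use hermitian_index[OF assms] assms(2) in auto)

lemma expect_uminus:
  assumes "X \<in> carrier_mat n n" "x \<in> carrier_vec n"
  shows "expect (- X) x = - expect X x"
  using assms by (simp add: expect_sum[of _ n] sum_negf)

text \<open>The set of product values of \<open>- X\<close> is the reflection of that of
  \<open>X\<close>, and both extrema are attained. This carries results on the maximum over to the
  minimum.\<close>

lemma lambda_max_prod_uminus:
  assumes X: "X \<in> carrier_mat (K * M) (K * M)" and pos: "K > 0" "M > 0"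
  shows "lambda_max_prod K M (- X) = - lambda_min_prod K M X"
proof -
  have X': "- X \<in> carrier_mat (K * M) (K * M)" using X by simp
  have *: "r \<in> product_values K M (- X) \<longleftrightarrow> - r \<in> product_values K M X" for r
  proof -
    have "Re (expect (- X) (tensor_vec a b)) = - Re (expect X (tensor_vec a b))"
      if "a \<in> unit_vecs K" "b \<in> unit_vecs M" for a b
      using that expect_uminus[OF X tensor_carrier, of a b] by (simp add: unit_vecs_def)
    then show ?thesis
      unfolding product_values_def by (auto; metis minus_minus)
  qed
  show ?thesis
    using product_values_max[OF X' pos] product_values_min[OF X pos] *
    by (metis antisym minus_minus minus_le_iff)
qed

section \<open>Polynomial multiplication as a linear map\<close>

text \<open>The matrix of polynomial multiplication: it sends \<open>tensor_vec a b\<close> to the coefficients of the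
  product of the polynomials with coefficients \<open>a\<close> and \<open>b\<close>.\<close>

definition convolution_mat :: "nat \<Rightarrow> nat \<Rightarrow> complex mat" where
  "convolution_mat K M =
     mat (K + M - 1) (K * M) (\<lambda>(l, t). if t div M + t mod M = l then 1 else 0)"

text \<open>A product of nonzero polynomials is nonzero: with \<open>i\<close> and \<open>j\<close>
  the lowest indices of nonzero coefficients, the coefficient of the product at \<open>i + j\<close>
  is the single term \<open>a $ i * b $ j\<close>.\<close>

lemma convolution_mat_tensor_nonzero:
  assumes a: "a \<in> carrier_vec K" "a \<noteq> 0\<^sub>v K" and b: "b \<in> carrier_vec M" "b \<noteq> 0\<^sub>v M"
  shows "convolution_mat K M *\<^sub>v tensor_vec a b \<noteq> 0\<^sub>v (K + M - 1)"
proof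
  assume zero: "convolution_mat K M *\<^sub>v tensor_vec a b = 0\<^sub>v (K + M - 1)"
  define i j where "i = (LEAST i. i < K \<and> a $ i \<noteq> 0)" "j = (LEAST j. j < M \<and> b $ j \<noteq> 0)"
  have "\<exists>i. i < K \<and> a $ i \<noteq> 0" "\<exists>j. j < M \<and> b $ j \<noteq> 0"
    using a b by (metis carrier_vecD eq_vecI index_zero_vec)+
  then have i: "i < K" "a $ i \<noteq> 0" and j: "j < M" "b $ j \<noteq> 0"
    unfolding i_j_def by (metis (mono_tags, lifting) LeastI_ex)+
  have a_min: "a $ i' = 0" if "i' < i" for i'
    using not_less_Least[of i' "\<lambda>i. i < K \<and> a $ i \<noteq> 0"] that i(1) by (auto simp: i_j_def)
  have b_min: "b $ j' = 0" if "j' < j" for j'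
    using not_less_Least[of j' "\<lambda>j. j < M \<and> b $ j \<noteq> 0"] that j(1) by (auto simp: i_j_def)
  have l: "i + j < K + M - 1" using i j by linarith
  have tc: "tensor_vec a b \<in> carrier_vec (K * M)" using a b by blast
  have "(convolution_mat K M *\<^sub>v tensor_vec a b) $ (i + j) = (\<Sum>t<K * M.
      (if t div M + t mod M = i + j then 1 else 0) * (a $ (t div M) * b $ (t mod M)))"
    using l tc a b
    by (auto simp: convolution_mat_def scalar_prod_def atLeast0LessThan tensor_index
        intro!: sum.cong)
  also have "\<dots> = (\<Sum>t\<in>{i * M + j}.
      (if t div M + t mod M = i + j then 1 else 0) * (a $ (t div M) * b $ (t mod M)))"
  proof (intro sum.mono_neutral_right ballI)
    fix t assume t: "t \<in> {..<K * M} - {i * M + j}"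
    show "(if t div M + t mod M = i + j then 1 else 0) * (a $ (t div M) * b $ (t mod M)) = 0"
    proof (cases "t div M + t mod M = i + j")
      case True
      have "\<not> (t div M = i \<and> t mod M = j)"
        using t div_mult_mod_eq[of t M] by auto
      \<comment> \<open>A different index pair with the same sum has one component below its
        minimum, where the coefficient vanishes.\<close>
      then have "t div M < i \<or> t mod M < j"
        using True by linarith
      then show ?thesis using a_min b_min by auto
    qed simp
  qed (use tensor_index_combine[OF i(1) j(1)] in auto)
  also have "\<dots> = a $ i * b $ j"
    using tensor_index_combine[OF i(1) j(1)] by simp
  finally show False
    using zero l i j by simp
qed

section \<open>The two bounds and their sharpness\<close>

theorem proposition5:
  fixes K M :: nat
  assumes "K \<ge> 2" and "M \<ge> 2"
  shows "(\<forall>X \<in> carrier_mat (K * M) (K * M). hermitian X \<longrightarrow>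
            lambda_max_prod K M X \<ge> eigval (K + M - 1) X \<and>
            lambda_min_prod K M X \<le> eigval ((K - 1) * (M - 1) + 1) X) \<and>
         (\<exists>X\<^sub>1 \<in> carrier_mat (K * M) (K * M). \<exists>X\<^sub>2 \<in> carrier_mat (K * M) (K * M).
            hermitian X\<^sub>1 \<and> hermitian X\<^sub>2 \<and>
            lambda_max_prod K M X\<^sub>1 < eigval (K + M) X\<^sub>1 \<and>
            lambda_min_prod K M X\<^sub>2 > eigval ((K - 1) * (M - 1)) X\<^sub>2)"
proof -
  let ?n = "K * M"
  define d where "d = (K - 1) * (M - 1)"
  have pos: "K > 0" "M > 0" using assms by auto
  \<comment> \<open>By this complementarity the \<open>K + M - 1\<close>-th eigenvalue from the top
    is \<open>eigval (d + 1) X\<close>, and the \<open>d\<close>-th from the top is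
    \<open>eigval (K + M) X\<close>. That \<open>d\<close> is at least 1 makes
    \<open>eigval d\<close> meaningful with 1-based indices.\<close>
  have d: "d + (K + M - 1) = ?n" "d \<ge> 1"
  proof -
    obtain k m where "K = k + 2" "M = m + 2"
      using assms by (metis add.commute le_Suc_ex)
    then show "d + (K + M - 1) = ?n" "d \<ge> 1"
      by (simp_all add: d_def algebra_simps)
  qed
  have "eigval (K + M - 1) X \<le> lambda_max_prod K M X \<and> lambda_min_prod K M X \<le> eigval (d + 1) X"
    if X: "X \<in> carrier_mat ?n ?n" and H: "hermitian X" for X
  proof
    obtain L C where L: "L \<in> carrier_mat ?n (K + M)" and C: "C \<in> carrier_mat 1 (K + M)"
      and LC: "\<forall>s \<in> carrier_vec (K + M). s \<noteq> 0\<^sub>v (K + M) \<and> C *\<^sub>v s = 0\<^sub>v 1 \<longrightarrow>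
        L *\<^sub>v s \<noteq> 0\<^sub>v ?n \<and>
        Re (expect X (L *\<^sub>v s)) \<le> lambda_max_prod K M X * Re ((L *\<^sub>v s) \<bullet>c (L *\<^sub>v s))"
      using max_tangent_space[OF X pos] by blast
    show "eigval (K + M - 1) X \<le> lambda_max_prod K M X"
      by (rule eigval_le[OF H X L C]) (use LC d pos in auto)
    have X': "- X \<in> carrier_mat ?n ?n" using X by simp
    obtain L C where L: "L \<in> carrier_mat ?n (K + M)" and C: "C \<in> carrier_mat 1 (K + M)"
      and LC: "\<forall>s \<in> carrier_vec (K + M). s \<noteq> 0\<^sub>v (K + M) \<and> C *\<^sub>v s = 0\<^sub>v 1 \<longrightarrow>
        L *\<^sub>v s \<noteq> 0\<^sub>v ?n \<and>
        Re (expect (- X) (L *\<^sub>v s)) \<le> lambda_max_prod K M (- X) * Re ((L *\<^sub>v s) \<bullet>c (L *\<^sub>v s))"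
      using max_tangent_space[OF X' pos] by blast
    \<comment> \<open>The tangent space is taken at a maximizer for \<open>- X\<close>, which is a
      minimizer for \<open>X\<close>. Its dimension \<open>K + M - 1\<close> is now counted from the
      top of the spectrum.\<close>
    have "lambda_min_prod K M X \<le> eigval (?n + 1 - (K + M - 1)) X"
    proof (rule eigval_ge[OF H X L C])
      fix s :: "complex vec"
      assume s: "s \<in> carrier_vec (K + M)" "s \<noteq> 0\<^sub>v (K + M)" "C *\<^sub>v s = 0\<^sub>v 1"
      have Ls: "L *\<^sub>v s \<in> carrier_vec ?n" using L s by auto
      show "L *\<^sub>v s \<noteq> 0\<^sub>v ?n \<and>
          lambda_min_prod K M X * Re ((L *\<^sub>v s) \<bullet>c (L *\<^sub>v s)) \<le> Re (expect X (L *\<^sub>v s))"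
        using bspec[OF LC s(1)] s(2,3) expect_uminus[OF X Ls] lambda_max_prod_uminus[OF X pos] by simp
    qed (use d pos in auto)
    also have "?n + 1 - (K + M - 1) = d + 1" using d by linarith
    finally show "lambda_min_prod K M X \<le> eigval (d + 1) X" .
  qed
  moreover have "\<exists>X\<^sub>1 \<in> carrier_mat ?n ?n. \<exists>X\<^sub>2 \<in> carrier_mat ?n ?n. hermitian X\<^sub>1 \<and> hermitian X\<^sub>2 \<and>
      lambda_max_prod K M X\<^sub>1 < eigval (K + M) X\<^sub>1 \<and> lambda_min_prod K M X\<^sub>2 > eigval d X\<^sub>2"
  proof -
    define A where "A = convolution_mat K M"
    define X where "X = mat_adjoint A * A"
    have A: "A \<in> carrier_mat (K + M - 1) ?n" by (simp add: A_def convolution_mat_def)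
    note Aa = adjoint_carrier[OF A]
    have X: "X \<in> carrier_mat ?n ?n" using A Aa by (auto simp: X_def)
    then have X': "- X \<in> carrier_mat ?n ?n" by simp
    have H: "hermitian X"
      unfolding hermitian_def X_def by (simp add: adjoint_mult[OF Aa A])
    note H' = hermitian_uminus[OF H X]
    have E: "expect X x = (A *\<^sub>v x) \<bullet>c (A *\<^sub>v x)" if x: "x \<in> carrier_vec ?n" for x
      using adjoint_inner[OF Aa, of "A *\<^sub>v x" x] A x
      by (simp add: expect_def X_def assoc_mult_mat_vec[OF Aa A x])
    have ker: "1\<^sub>m ?n *\<^sub>v s \<noteq> 0\<^sub>v ?n \<and> expect X (1\<^sub>m ?n *\<^sub>v s) = 0"
      if s: "s \<in> carrier_vec ?n" "s \<noteq> 0\<^sub>v ?n" "A *\<^sub>v s = 0\<^sub>v (K + M - 1)" for s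
      using s E[OF s(1)] by simp
    have one: "1\<^sub>m ?n \<in> carrier_mat ?n ?n" by simp
    \<comment> \<open>Strictness comes from attainment: the minimum is the squared norm of
      \<open>A\<close> applied to one nonzero product vector, so it is positive.\<close>
    have min_pos: "lambda_min_prod K M X > 0"
    proof -
      obtain a b where ab: "a \<in> unit_vecs K" "b \<in> unit_vecs M"
        and min: "lambda_min_prod K M X = Re (expect X (tensor_vec a b))"
        using product_values_min(1)[OF X pos] by (auto simp: product_values_def)
      then have c: "a \<in> carrier_vec K" "a \<noteq> 0\<^sub>v K" "b \<in> carrier_vec M" "b \<noteq> 0\<^sub>v M"
        by (auto simp: unit_vecs_def)
      note t = tensor_carrier[OF c(1,3)]
      have "A *\<^sub>v tensor_vec a b \<in> carrier_vec (K + M - 1)" using A t by auto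
      then show ?thesis
        unfolding min E[OF t] A_def
        using convolution_mat_tensor_nonzero[OF c] by (intro inner_self_pos) (auto simp: A_def)
    qed
    \<comment> \<open>The test space is the kernel of \<open>A\<close>, with the identity as
      \<open>L\<close>. It has dimension at least \<open>?n - (K + M - 1) = d\<close>, and the forms
      of \<open>X\<close> and \<open>- X\<close> both vanish on it, which bounds the
      \<open>d\<close>-th eigenvalue of \<open>X\<close> from below the spectrum and that of
      \<open>- X\<close> from the top.\<close>
    have "eigval d X \<le> 0"
      by (rule eigval_le[OF H X one A]) (use d ker in auto)
    moreover have "0 \<le> eigval (?n + 1 - d) (- X)"
      by (rule eigval_ge[OF H' X' one A]) (use d ker expect_uminus[OF X] in auto)
    moreover have "?n + 1 - d = K + M" using d pos by linarith
    moreover have "lambda_max_prod K M (- X) < 0"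
      using min_pos lambda_max_prod_uminus[OF X pos] by simp
    ultimately show ?thesis
      using X X' H H' min_pos by (intro bexI[of _ "- X"] bexI[of _ X]) auto
  qed
  ultimately show ?thesis unfolding d_def by blast
qed

end
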